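(* There exist unit disk graphs on $n$ vertices, any biclique cover of which has size $\Omega(n^{4/3})$. That is, there is a constant $c>0$ such that for every sufficiently large $n$ there is a unit disk graph on $n$ vertices every biclique cover of which has size at least $c\,n^{4/3}$.
   Context: All graphs are finite and simple. A biclique is a complete bipartite graph. A biclique cover of a graph $G$ is a collection $\mathcal{H}$ of (not necessarily induced) subgraphs of $G$, each of which is a biclique, such that every edge of $G$ belongs to at least one member of $\mathcal{H}$. The size of $\mathcal{H}$ is $\sum_{H\in\mathcal{H}}|V(H)|$. A unit disk graph is the intersection graph of a finite collection of closed disks of radius $1$ in the plane $\mathbb{R}^2$: vertices correspond to the disks, and two distinct vertices are adjacent if and only if the corresponding disks have nonempty intersection. *)

theory Defs
  imports "HOL-Analysis.Analysis" "Graph_Theory.Graph_Theory"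
begin

text \<open>
  A finite simple graph is a \<^locale>\<open>pair_graph\<close>: a finite, loop-free, symmetric set of pairs of
  vertices, each undirected edge being represented by its two orientations.
\<close>

text \<open>
  The map \<open>D\<close> sends each vertex to its disk; it is injective, as the vertices correspond
  one-to-one to the disks of the collection.
\<close>

definition unit_disk_graph :: "'a pair_pre_digraph \<Rightarrow> bool" where
  "unit_disk_graph G \<longleftrightarrow> pair_graph G \<and>
    (\<exists>D :: 'a \<Rightarrow> (real ^ 2) set.
      inj_on D (pverts G) \<and>
      (\<forall>v \<in> pverts G. \<exists>x. D v = cball x 1) \<and>
      (\<forall>u \<in> pverts G. \<forall>v \<in> pverts G.
        (u, v) \<in> parcs G \<longleftrightarrow> u \<noteq> v \<and> D u \<inter> D v \<noteq> {}))"

text \<open>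
  As in \<^const>\<open>complete_bipartite_digraph\<close>, a side of the bipartition may be empty. Such a
  biclique has no edges.
\<close>

definition biclique :: "'a pair_pre_digraph \<Rightarrow> bool" where
  "biclique H \<longleftrightarrow> (\<exists>m n. complete_bipartite_digraph m n (with_proj H))"

definition biclique_cover :: "'a pair_pre_digraph \<Rightarrow> 'a pair_pre_digraph set \<Rightarrow> bool" where
  "biclique_cover G \<H> \<longleftrightarrow>
    (\<forall>H \<in> \<H>. subgraph (with_proj H) (with_proj G) \<and> biclique H) \<and>
    (\<forall>e \<in> parcs G. \<exists>H \<in> \<H>. e \<in> parcs H)"

definition cover_size :: "'a pair_pre_digraph set \<Rightarrow> nat" where
  "cover_size \<H> = (\<Sum>H \<in> \<H>. card (pverts H))"

text \<open>
  Covers of a finite graph are finite, so the sum in \<^const>\<open>cover_size\<close> is not the junk value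
  of a sum over an infinite set.
\<close>

lemma finite_biclique_cover:
  assumes "pair_graph G" "biclique_cover G \<H>"
  shows "finite \<H>"
proof -
  interpret pair_graph G by fact
  have "(\<lambda>H. (pverts H, parcs H)) ` \<H> \<subseteq> Pow (pverts G) \<times> Pow (parcs G)"
    using assms(2) by (force simp: biclique_cover_def subgraph_def)
  moreover have "finite (Pow (pverts G) \<times> Pow (parcs G))"
    using pair_finite_verts pair_finite_arcs by simp
  moreover have "inj_on (\<lambda>H. (pverts H, parcs H)) \<H>"
    by (auto simp: inj_on_def)
  ultimately show ?thesis
    by (meson finite_imageD finite_subset)
qed

end

theory Submission
  imports Defs
begin

text \<open>
  Take the points \<open>(x, y)\<close> with \<open>x < N\<close>, \<open>y < 2 N\<^sup>2\<close> and the lines \<open>y = m x + k\<close> with \<open>m < N\<close>,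
  \<open>k < N\<^sup>2\<close>: these are \<open>3 N\<^sup>3\<close> objects with \<open>N\<^sup>4\<close> incidences. If every point of \<open>A\<close> lies on or below
  every line of \<open>B\<close>, then the points of \<open>A\<close> that lie on lines of \<open>B\<close> are in convex position up to
  collinearity, so there are only \<open>|A| + 2 |B|\<close> incidences between \<open>A\<close> and \<open>B\<close>. Hence a biclique
  cover of any graph in which point-line adjacency means ``on or below'' has size at least \<open>N\<^sup>4 / 3\<close>.
  Such a graph is a unit disk graph: near the origin a disk of radius 2 looks like a half-plane, and
  a half-integer shift of the lines leaves room for the curvature error.
\<close>

section \<open>Incidences between points and lines when every point is on or below every
  line\<close>

definition on_or_below :: "nat \<times> nat \<Rightarrow> nat \<times> nat \<Rightarrow> bool" where
  "on_or_below p l \<longleftrightarrow> snd p \<le> fst l * fst p + snd l"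

definition incident :: "nat \<times> nat \<Rightarrow> nat \<times> nat \<Rightarrow> bool" where
  "incident p l \<longleftrightarrow> snd p = fst l * fst p + snd l"

definition incidences :: "(nat \<times> nat) set \<Rightarrow> (nat \<times> nat) set \<Rightarrow> ((nat \<times> nat) \<times> (nat \<times> nat)) set" where
  "incidences A B = {(p, l) \<in> A \<times> B. incident p l}"

lemma incident_fst_eqD:
  assumes "incident p l" "incident q l" "fst p = fst q"
  shows "p = q"
  using assms by (auto simp: incident_def prod_eq_iff)

text \<open>Both lines pass through \<open>q\<close>. If \<open>l'\<close> were steeper than
  \<open>l\<close>, it would run strictly below \<open>p\<close>, to the left of \<open>q\<close>;
  if flatter, strictly below \<open>r\<close>, to the right. So the slopes agree.\<close>

lemma incident_between_unique:
  assumes "incident p l" "incident q l" "incident r l"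
    and "fst p < fst q" "fst q < fst r"
    and "incident q l'" "on_or_below p l'" "on_or_below r l'"
  shows "l' = l"
proof -
  obtain m k m' k' where l: "l = (m, k)" "l' = (m', k')" by fastforce
  define a b c where "a = int (fst p)" and "b = int (fst q)" and "c = int (fst r)"
  have eqs: "int (snd p) = int m * a + int k" "int (snd q) = int m * b + int k"
    "int (snd r) = int m * c + int k" "int (snd q) = int m' * b + int k'"
    using assms(1-3,6) by (simp_all add: incident_def l a_def b_def c_def flip: of_nat_mult of_nat_add)
  have le: "int (snd p) \<le> int m' * a + int k'" "int (snd r) \<le> int m' * c + int k'"
    using assms(7,8) unfolding on_or_below_def l a_def c_def
    by (simp_all flip: of_nat_mult of_nat_add)
  have "(int m' - int m) * (b - a) \<le> 0" "(int m' - int m) * (c - b) \<ge> 0"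
    using eqs le by (simp_all add: algebra_simps)
  moreover have "b - a > 0" "c - b > 0"
    using assms(4,5) by (simp_all add: a_def b_def c_def)
  ultimately have "int m' = int m"
    by (simp add: mult_le_0_iff zero_le_mult_iff)
  then show ?thesis using eqs l by simp
qed

text \<open>Set aside, for each line, its leftmost and its rightmost point of \<open>A\<close>: at
  most two incidences per line, collected in \<open>L\<close> and \<open>R\<close>. In any other
  incidence the point lies strictly between two points of \<open>A\<close> on the line, so by
  \<open>incident_between_unique\<close> it determines the line: at most one incidence per point,
  collected in \<open>M\<close>.\<close>

lemma card_incidences_le:
  assumes fin: "finite A" "finite B"
    and below: "\<And>p l. p \<in> A \<Longrightarrow> l \<in> B \<Longrightarrow> on_or_below p l"
  shows "card (incidences A B) \<le> card A + 2 * card B"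
proof -
  let ?T = "incidences A B"
  define L where "L = {(p, l) \<in> ?T. \<forall>q\<in>A. incident q l \<longrightarrow> fst p \<le> fst q}"
  define R where "R = {(p, l) \<in> ?T. \<forall>q\<in>A. incident q l \<longrightarrow> fst q \<le> fst p}"
  define M where "M = ?T - (L \<union> R)"
  have "inj_on snd L" "inj_on snd R"
    by (auto simp: inj_on_def L_def R_def incidences_def)
      (metis incident_fst_eqD antisym fst_conv prod.inject)+
  then have "card L \<le> card B" "card R \<le> card B"
    by (auto intro!: card_inj_on_le[where f = snd] simp: fin L_def R_def incidences_def)
  moreover have "inj_on fst M"
  proof (rule inj_onI)
    fix u v assume "u \<in> M" "v \<in> M" "fst u = fst v"
    then obtain q l l' where uv: "u = (q, l)" "v = (q, l')" and M: "(q, l) \<in> M" "(q, l') \<in> M"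
      by (metis prod.collapse)
    obtain p r where "p \<in> A" "incident p l" "fst p < fst q" "r \<in> A" "incident r l" "fst q < fst r"
      using M(1) by (force simp: M_def L_def R_def not_le)
    moreover have "l' \<in> B" "incident q l" "incident q l'"
      using M by (auto simp: M_def incidences_def)
    ultimately have "l' = l"
      using incident_between_unique below by metis
    then show "u = v" by (simp add: uv)
  qed
  then have "card M \<le> card A"
    by (auto intro!: card_inj_on_le[where f = fst] simp: fin M_def incidences_def)
  moreover have "?T = L \<union> R \<union> M"
    by (auto simp: M_def L_def R_def)
  then have "card ?T \<le> card L + card R + card M"
    by (metis card_Un_le add_le_mono1 order_trans)
  ultimately show ?thesis by simp
qed

lemma card_grid_incidences:
  "card (incidences ({..<N} \<times> {..<2 * N^2}) ({..<N} \<times> {..<N^2})) \<ge> N^4"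
proof -
  let ?I = "incidences ({..<N} \<times> {..<2 * N^2}) ({..<N} \<times> {..<N^2})"
  let ?f = "\<lambda>(x, m, k). ((x, m * x + k), (m, k)) :: (nat \<times> nat) \<times> nat \<times> nat"
  \<comment> \<open>The height of the point grid is chosen for this bound: each of the
    \<open>N^3\<close> lines then has a grid point in each of the \<open>N\<close> columns.\<close>
  have "m * x + k < 2 * N^2" if "x < N" "m < N" "k < N^2" for x m k
  proof -
    have "m * x \<le> N * N" using that by (intro mult_mono) auto
    then show ?thesis using that by (simp add: power2_eq_square)
  qed
  then have "?f ` ({..<N} \<times> {..<N} \<times> {..<N^2}) \<subseteq> ?I"
    by (auto simp: incidences_def incident_def)
  moreover have "inj_on ?f ({..<N} \<times> {..<N} \<times> {..<N^2})"
    by (auto simp: inj_on_def)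
  moreover have "finite ?I"
    by (rule finite_subset[of _ "({..<N} \<times> {..<2 * N^2}) \<times> ({..<N} \<times> {..<N^2})"])
      (auto simp: incidences_def)
  ultimately have "card ({..<N} \<times> {..<N} \<times> {..<N^2}) \<le> card ?I"
    by (intro card_inj_on_le[where f = ?f])
  then show ?thesis by (simp add: card_cartesian_product eval_nat_numeral)
qed

text \<open>A biclique in the cover has only edges of \<open>G\<close>, so the points on one side
  are on or below the lines on the other, and \<open>card_incidences_le\<close> bounds its
  incidences linearly in its vertices. Every incidence is an edge of \<open>G\<close>, so it is
  counted for some member of the cover.\<close>

lemma card_incidences_le_cover_size:
  fixes G :: "'a pair_pre_digraph"
  assumes G: "pair_graph G" and cover: "biclique_cover G \<H>"
    and fin: "finite A" "finite B" and inj: "inj_on f A" "inj_on g B"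
    and adj: "\<And>p l. p \<in> A \<Longrightarrow> l \<in> B \<Longrightarrow> (f p, g l) \<in> parcs G \<longleftrightarrow> on_or_below p l"
  shows "card (incidences A B) \<le> 3 * cover_size \<H>"
proof -
  define E where "E H = {(p, l) \<in> incidences A B. (f p, g l) \<in> parcs H}"
    for H :: "'a pair_pre_digraph"
  have E_le: "card (E H) \<le> 3 * card (pverts H)" if H: "H \<in> \<H>" for H
  proof -
    obtain U V where UV: "finite (pverts H)" "pverts H = U \<union> V" "U \<inter> V = {}"
      "parcs H = U \<times> V \<union> V \<times> U"
      using cover H by (auto simp: biclique_cover_def biclique_def complete_bipartite_digraph_pair_def)
    have sub: "parcs H \<subseteq> parcs G"
      using cover H by (auto simp: biclique_cover_def subgraph_def)
    have finUV: "finite U" "finite V" using UV by auto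
    have half: "card (incidences {p \<in> A. f p \<in> X} {l \<in> B. g l \<in> Y}) \<le> card X + 2 * card Y"
      if XY: "X \<times> Y \<subseteq> parcs H" "finite X" "finite Y" for X Y
    proof -
      have "card {p \<in> A. f p \<in> X} \<le> card X"
        using inj(1) XY by (intro card_inj_on_le[where f = f]) (auto simp: inj_on_def)
      moreover have "card {l \<in> B. g l \<in> Y} \<le> card Y"
        using inj(2) XY by (intro card_inj_on_le[where f = g]) (auto simp: inj_on_def)
      moreover have "card (incidences {p \<in> A. f p \<in> X} {l \<in> B. g l \<in> Y})
          \<le> card {p \<in> A. f p \<in> X} + 2 * card {l \<in> B. g l \<in> Y}"
        using fin XY sub by (intro card_incidences_le) (auto simp flip: adj)
      ultimately show ?thesis by linarith
    qed
    let ?I = "\<lambda>X Y. incidences {p \<in> A. f p \<in> X} {l \<in> B. g l \<in> Y}"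
    have finI: "finite (?I X Y)" for X Y
      by (rule finite_subset[of _ "A \<times> B"]) (auto simp: incidences_def fin)
    \<comment> \<open>Either side of a biclique may hold points as well as lines, so incidences are
      split by the side containing the point. The weights 1 and 2 are then exchanged between the
      sides and add up to 3 per vertex.\<close>
    have "E H \<subseteq> ?I U V \<union> ?I V U"
      using UV by (auto simp: E_def incidences_def)
    then have "card (E H) \<le> card (?I U V \<union> ?I V U)"
      using finI by (intro card_mono) auto
    also have "\<dots> \<le> card (?I U V) + card (?I V U)" by (rule card_Un_le)
    also have "\<dots> \<le> (card U + 2 * card V) + (card V + 2 * card U)"
      using UV(4) finUV by (intro add_mono half) auto
    also have "\<dots> = 3 * card (pverts H)"
      using UV finUV by (simp add: card_Un_disjoint)
    finally show ?thesis .
  qed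
  have finH: "finite \<H>" by (rule finite_biclique_cover) fact+
  have "incidences A B \<subseteq> (\<Union>H\<in>\<H>. E H)"
  proof safe
    fix p l assume I: "(p, l) \<in> incidences A B"
    then have "(f p, g l) \<in> parcs G"
      using adj by (auto simp: incidences_def incident_def on_or_below_def)
    then show "(p, l) \<in> (\<Union>H\<in>\<H>. E H)"
      using cover I by (force simp: biclique_cover_def E_def)
  qed
  moreover have "finite (E H)" for H
    by (rule finite_subset[of _ "A \<times> B"]) (auto simp: E_def incidences_def fin)
  ultimately have "card (incidences A B) \<le> card (\<Union>H\<in>\<H>. E H)"
    using finH by (intro card_mono) auto
  also have "\<dots> \<le> (\<Sum>H\<in>\<H>. card (E H))"
    by (rule card_UN_le) fact
  also have "\<dots> \<le> (\<Sum>H\<in>\<H>. 3 * card (pverts H))"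
    by (intro sum_mono E_le)
  finally show ?thesis by (simp add: cover_size_def sum_distrib_left)
qed

section \<open>Realization by unit disks\<close>

lemma cball_Int_cball_nonempty_iff:
  fixes x y :: "'a :: real_normed_vector"
  shows "cball x r \<inter> cball y r \<noteq> {} \<longleftrightarrow> dist x y \<le> 2 * r"
proof
  assume "cball x r \<inter> cball y r \<noteq> {}"
  then obtain z where "dist x z \<le> r" "dist y z \<le> r" by auto
  then show "dist x y \<le> 2 * r" using dist_triangle2[of x y z] by linarith
next
  assume "dist x y \<le> 2 * r"
  then have "midpoint x y \<in> cball x r \<inter> cball y r"
    by (simp add: dist_midpoint)
  then show "cball x r \<inter> cball y r \<noteq> {}" by blast
qed

lemma unit_disk_graph_containing_centers:
  fixes S :: "(real ^ 2) set"
  assumes "finite S" "card S \<le> n"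
  obtains G :: "nat pair_pre_digraph" and h :: "real ^ 2 \<Rightarrow> nat"
  where "unit_disk_graph G" "card (pverts G) = n" "inj_on h S"
    "\<And>p q. p \<in> S \<Longrightarrow> q \<in> S \<Longrightarrow> (h p, h q) \<in> parcs G \<longleftrightarrow> p \<noteq> q \<and> dist p q \<le> 2"
proof -
  \<comment> \<open>Extra centers \<open>P\<close> outside \<open>S\<close> bring the number of
    vertices to exactly \<open>n\<close>. They may create further edges, but the adjacency claim
    concerns pairs in \<open>S\<close> alone.\<close>
  have "infinite (UNIV - S)"
    using assms(1) by (simp add: infinite_UNIV_char_0 Diff_infinite_finite)
  then obtain P where P: "P \<subseteq> UNIV - S" "finite P" "card P = n - card S"
    using infinite_arbitrarily_large by blast
  have ST: "finite (S \<union> P)" "card (S \<union> P) = n"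
    using P assms by (simp_all add: card_Un_disjoint Int_commute disjoint_eq_subset_Compl Compl_eq_Diff_UNIV)
  then obtain c where c: "bij_betw c {..<n} (S \<union> P)"
    using ex_bij_betw_nat_finite by (metis atLeast0LessThan)
  define h where "h = the_inv_into {..<n} c"
  define G :: "nat pair_pre_digraph" where
    "G = \<lparr>pverts = {..<n}, parcs = {(u, v) \<in> {..<n} \<times> {..<n}. u \<noteq> v \<and> dist (c u) (c v) \<le> 2}\<rparr>"
  have h: "bij_betw h (S \<union> P) {..<n}" and ch: "\<And>p. p \<in> S \<union> P \<Longrightarrow> c (h p) = p"
    using c bij_betw_the_inv_into[OF c]
    by (simp_all add: h_def bij_betw_def f_the_inv_into_f)
  have "pair_graph G"
  proof
    show "finite (parcs G)"
      by (rule finite_subset[of _ "{..<n} \<times> {..<n}"]) (auto simp: G_def)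
    show "symmetric (with_proj G)"
      by (auto simp: G_def symmetric_def dist_commute intro!: symI)
  qed (auto simp: G_def)
  then have "unit_disk_graph G"
    using c unfolding unit_disk_graph_def
    by (intro conjI exI[of _ "\<lambda>v. cball (c v) 1"])
      (auto simp: G_def cball_Int_cball_nonempty_iff bij_betw_def inj_on_def cball_eq_cball_iff)
  moreover have "card (pverts G) = n" by (simp add: G_def)
  moreover have "inj_on h S"
    using h by (auto simp: bij_betw_def inj_on_def)
  moreover have "(h p, h q) \<in> parcs G \<longleftrightarrow> p \<noteq> q \<and> dist p q \<le> 2" if "p \<in> S" "q \<in> S" for p q
    using that h ch[of p] ch[of q] by (auto simp: G_def bij_betw_def)
  ultimately show thesis using that by blast
qed

lemma dist_vector_2:
  "dist (vector [a, b] :: real ^ 2) (vector [c, d]) = sqrt ((a - c)^2 + (b - d)^2)"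
  by (simp add: dist_vec_def L2_set_def sum_2 dist_real_def)

lemma vector_2_eq_iff:
  "(vector [a, b] :: real ^ 2) = vector [c, d] \<longleftrightarrow> a = c \<and> b = d"
  by (auto simp: vec_eq_iff forall_2)

text \<open>
  The center of the disk for the line \<open>y = m x + k\<close> has second coordinate
  \<open>-2 + \<delta>\<^sup>2 m\<^sup>2 + \<delta>\<^sup>3 (k + 1/2)\<close>. This choice makes the terms of order at most \<open>\<delta>\<^sup>3\<close> in
  \<open>|P - L|\<^sup>2 - 4\<close> add up to \<open>4 \<delta>\<^sup>3 (y - m x - k - 1/2)\<close>; what remains is of order \<open>\<delta>\<^sup>4\<close>.
\<close>

lemma half_planes_as_disks:
  obtains P L :: "nat \<times> nat \<Rightarrow> real ^ 2"
  where "inj P" "inj L"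
    "\<And>p l. p \<in> {..<N} \<times> {..<2 * N^2} \<Longrightarrow> l \<in> {..<N} \<times> {..<N^2} \<Longrightarrow>
      P p \<noteq> L l \<and> (dist (P p) (L l) \<le> 2 \<longleftrightarrow> on_or_below p l)"
proof -
  \<comment> \<open>The remainder \<open>r\<close> below is at most \<open>5 * N^4\<close>, so the
    error \<open>\<delta> * r\<close> is at most 1. The summand 1 keeps the denominator positive
    when \<open>N = 0\<close>.\<close>
  define \<delta> :: real where "\<delta> = 1 / (5 * real N ^ 4 + 1)"
  have \<delta>: "\<delta> > 0" "\<delta> \<le> 1" "\<delta> * (5 * real N ^ 4) \<le> 1"
    by (auto simp: \<delta>_def field_simps add_pos_nonneg)
  define g where "g = (\<lambda>(m, k). real m ^ 2 + \<delta> * (real k + 1/2))"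
  define P :: "nat \<times> nat \<Rightarrow> real ^ 2" where
    "P = (\<lambda>(x, y). vector [\<delta>^2 * real x, \<delta>^3 * real y])"
  define L :: "nat \<times> nat \<Rightarrow> real ^ 2" where
    "L = (\<lambda>(m, k). vector [2 * \<delta> * real m, \<delta>^2 * g (m, k) - 2])"
  have "inj P" "inj L"
    using \<delta>(1) by (auto simp: inj_def P_def L_def vector_2_eq_iff g_def)
  moreover have "P (x, y) \<noteq> L (m, k) \<and> (dist (P (x, y)) (L (m, k)) \<le> 2 \<longleftrightarrow> on_or_below (x, y) (m, k))"
    if bounds: "x < N" "y < 2 * N^2" "m < N" "k < N^2" for x y m k
  proof -
    let ?n = "real N" and ?t = "real y - real m * real x - real k"
    \<comment> \<open>This is the coefficient of \<open>\<delta>^4\<close> in the squared distance.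
      The bound \<open>5 * N^4\<close> comes from \<open>N^4\<close> for the first square and
      \<open>(2 * N^2)^2\<close> for the second.\<close>
    define r where "r = real x ^ 2 + (g (m, k) - \<delta> * real y)^2"
    have n1: "1 \<le> ?n" using bounds by simp
    have n2: "1 \<le> ?n^2" "?n^2 \<le> ?n^4" using n1 by (auto intro: power_increasing)
    have y: "real y \<le> 2 * ?n^2"
      using bounds(2) by (metis of_nat_less_iff less_imp_le of_nat_mult of_nat_numeral of_nat_power)
    have k: "real k + 1/2 \<le> ?n^2"
    proof -
      have "real (k + 1) \<le> real (N^2)" using bounds(4) by (intro of_nat_mono) simp
      then show ?thesis by simp
    qed
    have \<delta>n: "\<delta> * (5 * ?n^2) \<le> 1"
      using \<delta> n2 by (meson mult_left_mono order_trans less_imp_le zero_le_numeral)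
    have dn0: "0 \<le> \<delta> * ?n^2" using \<delta>(1) by simp
    have dy: "0 \<le> \<delta> * real y" "\<delta> * real y \<le> 1"
      using \<delta>(1) mult_left_mono[OF y, of \<delta>] \<delta>n dn0 by (simp, linarith)
    have dk: "0 \<le> \<delta> * (real k + 1/2)" "\<delta> * (real k + 1/2) \<le> 1"
      using \<delta>(1) mult_left_mono[OF k, of \<delta>] \<delta>n dn0 by (simp, linarith)
    have m: "real m ^ 2 \<le> ?n^2" and x: "real x ^ 2 \<le> ?n^2"
      using bounds by (auto intro: power_mono)
    have g0: "0 \<le> g (m, k)" and g1: "g (m, k) \<le> 2 * ?n^2"
      using dk m n2(1) by (simp add: g_def, unfold g_def case_prod_conv, linarith)
    have "\<bar>g (m, k) - \<delta> * real y\<bar> \<le> 2 * ?n^2"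
      using g0 g1 dy n2 by linarith
    then have "(g (m, k) - \<delta> * real y)^2 \<le> (2 * ?n^2)^2"
      by (metis abs_ge_zero power2_abs power_mono)
    then have r: "r \<le> 5 * ?n^4"
      using x n2(2) by (simp add: power_mult_distrib flip: power_mult, unfold r_def, linarith)
    have r0: "0 \<le> \<delta> * r" using \<delta>(1) by (simp add: r_def)
    have r1: "\<delta> * r \<le> 1" using mult_left_mono[OF r, of \<delta>] \<delta> by linarith
    have sq: "(\<delta>^2 * real x - 2 * \<delta> * real m)^2 + (\<delta>^3 * real y - (\<delta>^2 * g (m, k) - 2))^2
        = 4 + \<delta>^3 * (4 * (?t - 1/2) + \<delta> * r)"
      by (simp add: g_def r_def power2_eq_square power3_eq_cube algebra_simps)
    have "dist (P (x, y)) (L (m, k)) \<le> 2 \<longleftrightarrow> 4 + \<delta>^3 * (4 * (?t - 1/2) + \<delta> * r) \<le> 2^2"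
      unfolding P_def L_def case_prod_conv dist_vector_2 sq
      using real_sqrt_le_iff[of _ "2^2"] by (simp only: real_sqrt_abs abs_numeral)
    also have "\<dots> \<longleftrightarrow> 4 * (?t - 1/2) + \<delta> * r \<le> 0"
      using \<delta>(1) by (simp add: mult_le_0_iff)
    also have "\<dots> \<longleftrightarrow> on_or_below (x, y) (m, k)"
    \<comment> \<open>Since \<open>?t\<close> is an integer, the half-integer shift makes
      \<open>4 * (?t - 1/2)\<close> at most -2 or at least 2. An error between 0 and 1 cannot change
      the sign.\<close>
    proof (cases "y \<le> m * x + k")
      case True
      then have "?t \<le> 0" by (simp flip: of_nat_mult of_nat_add)
      then show ?thesis using True r1 by (simp add: on_or_below_def)
    next
      case False
      then have "real (m * x + k + 1) \<le> real y" by (intro of_nat_mono) simp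
      then have "?t \<ge> 1" by simp
      then show ?thesis using False r0 by (simp add: on_or_below_def)
    qed
    finally have "dist (P (x, y)) (L (m, k)) \<le> 2 \<longleftrightarrow> on_or_below (x, y) (m, k)" .
    \<comment> \<open>This separates the two kinds of centers: those of lines have negative second
      coordinate, those of points a nonnegative one.\<close>
    moreover have "\<delta>^2 * g (m, k) < 2"
    proof -
      have "\<delta> * g (m, k) \<le> 1" using mult_left_mono[OF g1, of \<delta>] \<delta>(1) \<delta>n dn0 by linarith
      then have "\<delta> * (\<delta> * g (m, k)) \<le> 1 * 1" using \<delta> g0 by (intro mult_mono) auto
      then show ?thesis by (simp add: power2_eq_square mult.assoc)
    qed
    moreover have "0 \<le> \<delta>^3 * real y" using \<delta>(1) by simp
    ultimately show ?thesis by (auto simp: P_def L_def vector_2_eq_iff)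
  qed
  ultimately show thesis using that[of P L] by force
qed

section \<open>Graphs on exactly \<open>n\<close> vertices and the final estimate\<close>

lemma unit_disk_graph_cover_size:
  assumes "3 * N^3 \<le> n"
  obtains G :: "nat pair_pre_digraph"
  where "unit_disk_graph G" "card (pverts G) = n"
    "\<And>\<H>. biclique_cover G \<H> \<Longrightarrow> N^4 \<le> 3 * cover_size \<H>"
proof -
  let ?A = "{..<N} \<times> {..<2 * N^2}" and ?B = "{..<N} \<times> {..<N^2}"
  obtain P L :: "nat \<times> nat \<Rightarrow> real ^ 2"
    where "inj P" "inj L" and PL: "\<And>p l. p \<in> ?A \<Longrightarrow> l \<in> ?B \<Longrightarrow>
      P p \<noteq> L l \<and> (dist (P p) (L l) \<le> 2 \<longleftrightarrow> on_or_below p l)"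
    using half_planes_as_disks[of N] by blast
  have cards: "card (P ` ?A) \<le> 2 * N^3" "card (L ` ?B) \<le> N^3"
    using card_image_le[of ?A P] card_image_le[of ?B L]
    by (simp_all add: power2_eq_square power3_eq_cube)
  define S where "S = P ` ?A \<union> L ` ?B"
  have "finite S" by (simp add: S_def)
  moreover have "card S \<le> n"
    using card_Un_le[of "P ` ?A" "L ` ?B"] cards assms
    unfolding S_def by linarith
  ultimately obtain G :: "nat pair_pre_digraph" and h :: "real ^ 2 \<Rightarrow> nat"
    where G: "unit_disk_graph G" "card (pverts G) = n" and h: "inj_on h S"
    and adj: "\<And>p q. p \<in> S \<Longrightarrow> q \<in> S \<Longrightarrow> (h p, h q) \<in> parcs G \<longleftrightarrow> p \<noteq> q \<and> dist p q \<le> 2"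
    using unit_disk_graph_containing_centers by blast
  have "N^4 \<le> 3 * cover_size \<H>" if "biclique_cover G \<H>" for \<H>
  proof -
    have "card (incidences ?A ?B) \<le> 3 * cover_size \<H>"
    proof (rule card_incidences_le_cover_size[OF _ that])
      show "pair_graph G" using G(1) by (simp add: unit_disk_graph_def)
      show "inj_on (h \<circ> P) ?A" "inj_on (h \<circ> L) ?B"
        using \<open>inj P\<close> \<open>inj L\<close> h by (auto simp: S_def intro!: comp_inj_on intro: inj_on_subset)
      show "((h \<circ> P) p, (h \<circ> L) l) \<in> parcs G \<longleftrightarrow> on_or_below p l" if "p \<in> ?A" "l \<in> ?B" for p l
        using adj[of "P p" "L l"] PL[OF that] that by (simp add: S_def)
    qed auto
    then show ?thesis using card_grid_incidences[of N] by linarith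
  qed
  then show thesis using that G by blast
qed

lemma exists_scale:
  obtains N :: nat where "3 * N^3 \<le> n" "n < 3 * (Suc N)^3"
proof -
  have "n < 3 * (Suc n)^3"
    by (simp add: power3_eq_cube)
  then have ex: "\<exists>M. n < 3 * M^3" ..
  \<comment> \<open>\<open>M\<close> is the first scale that is too large, so its predecessor is the
    largest \<open>N\<close> that fits. \<open>M\<close> is positive because no natural number is
    below 0.\<close>
  define M where "M = (LEAST M. n < 3 * M^3)"
  have M: "n < 3 * M^3" unfolding M_def using ex by (rule LeastI_ex)
  then obtain N where N: "M = Suc N" by (cases M) auto
  have "\<not> n < 3 * N^3" using not_less_Least[of N "\<lambda>M. n < 3 * M^3"] N by (simp add: M_def)
  then show thesis using that[of N] M N by simp
qed

theorem lemma27: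
  shows "\<exists>c :: real. c > 0 \<and>
    (\<forall>\<^sub>F n in sequentially.
      \<exists>G :: nat pair_pre_digraph.
        unit_disk_graph G \<and> card (pverts G) = n \<and>
        (\<forall>\<H>. biclique_cover G \<H> \<longrightarrow> real (cover_size \<H>) \<ge> c * real n powr (4 / 3)))"
proof (rule exI[of _ "1 / 243"], rule conjI)
  show "(1 / 243 :: real) > 0" by simp
  show "\<forall>\<^sub>F n in sequentially. \<exists>G :: nat pair_pre_digraph. unit_disk_graph G \<and> card (pverts G) = n \<and>
      (\<forall>\<H>. biclique_cover G \<H> \<longrightarrow> 1 / 243 * real n powr (4 / 3) \<le> real (cover_size \<H>))"
  \<comment> \<open>From \<open>n = 3\<close> on, the scale \<open>N\<close> is at least 1, so that
    \<open>Suc N\<close> is at most \<open>2 * N\<close>.\<close>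
  proof (rule eventually_sequentiallyI[of 3])
    fix n :: nat assume n: "3 \<le> n"
    obtain N where N: "3 * N^3 \<le> n" "n < 3 * (Suc N)^3" by (rule exists_scale)
    have "N \<noteq> 0" using N n by (cases "N = 0") auto
    then have "(Suc N)^3 \<le> (2 * N)^3" by (intro power_mono) auto
    \<comment> \<open>The bound \<open>3 * (2 * N)^3 = 24 * N^3\<close> is rounded up to the cube
      \<open>27 * N^3\<close>, whose power 4/3 is \<open>81 * N^4\<close>. With the factor 3 from
      the covers, this gives the constant 1/243.\<close>
    then have "n \<le> (3 * N)^3" using N(2) by (simp add: power_mult_distrib)
    then have "real n powr (4/3) \<le> (real (3 * N) ^ 3) powr (4/3)"
      by (intro powr_mono2) (simp_all flip: of_nat_power)
    also have "\<dots> = real (3 * N) ^ 4"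
    proof -
      have "(real (3 * N) ^ 3) powr (4/3) = (real (3 * N) powr 3) powr (4/3)"
        using \<open>N \<noteq> 0\<close> by (subst powr_numeral) auto
      also have "\<dots> = real (3 * N) powr 4" unfolding powr_powr by simp
      also have "\<dots> = real (3 * N) ^ 4"
        using \<open>N \<noteq> 0\<close> by (subst powr_numeral) auto
      finally show ?thesis .
    qed
    finally have pow: "1 / 243 * real n powr (4/3) \<le> real (N^4) / 3"
      by (simp add: power_mult_distrib)
    obtain G :: "nat pair_pre_digraph" where G: "unit_disk_graph G" "card (pverts G) = n"
      "\<And>\<H>. biclique_cover G \<H> \<Longrightarrow> N^4 \<le> 3 * cover_size \<H>"
      using unit_disk_graph_cover_size[OF N(1)] by blast
    have "real (N^4) / 3 \<le> real (cover_size \<H>)" if "biclique_cover G \<H>" for \<H>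
      using of_nat_mono[OF G(3)[OF that], where 'a = real] by simp
    with pow have "1 / 243 * real n powr (4/3) \<le> real (cover_size \<H>)" if "biclique_cover G \<H>" for \<H>
      using that by (meson order_trans)
    with G(1,2) show "\<exists>G :: nat pair_pre_digraph. unit_disk_graph G \<and> card (pverts G) = n \<and>
        (\<forall>\<H>. biclique_cover G \<H> \<longrightarrow> 1 / 243 * real n powr (4 / 3) \<le> real (cover_size \<H>))"
      by blast
  qed
qed

end
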